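(* Let $m\ge 1$, let $(p_i(n))_{n\ge 0}$, $1\le i\le m$, be sequences of nonnegative real numbers with $\sum_{i=1}^m p_i(n)<1$ for all $n\ge 0$, and let $(\sigma_i(n))_{n\ge 1}$, $1\le i\le m$, be sequences of integers such that $\sigma_i(n)\ge n+1$ for all $n\ge 1$, $1\le i\le m$. Let $\rho(n)=\min_{1\le i\le m}\min_{s\ge n}\sigma_i(s)$ for $n\ge 1$, and let $b_r(n,k)$ be defined by $$b_1(n,k)=\prod_{i=n+1}^{k}\Big[1-\sum_{\ell=1}^m p_\ell(i)\Big],\qquad b_{r+1}(n,k)=\prod_{i=n+1}^{k}\Big[1-\sum_{\ell=1}^m p_\ell(i)\,b_r^{-1}(i,\sigma_\ell(i))\Big],\quad r\in\mathbb{N}.$$ If for some $r\in\mathbb{N}$ $$\limsup_{n\to\infty}\sum_{j=n}^{\rho(n)}\sum_{i=1}^{m}p_i(j)\,b_r^{-1}(\rho(n),\sigma_i(j))>1,$$ then all solutions of the difference equation $$\nabla x(n)-\sum_{i=1}^m p_i(n)\,x(\sigma_i(n))=0,\qquad n\ge 1,$$ oscillate.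
   Context: $\mathbb{N}=\{1,2,\dots\}$. $\nabla x(n)=x(n)-x(n-1)$. A solution of the equation is a real sequence $(x(n))_{n\ge 0}$ satisfying the equation for all $n\ge 1$. A solution is oscillatory (oscillates) if it is neither eventually positive nor eventually negative. Empty products equal $1$, and $b_r^{-1}(n,k)$ means $1/b_r(n,k)$. *)

theory Defs
  imports Complex_Main "HOL-Library.Extended_Real" "HOL-Library.Liminf_Limsup"
begin

text \<open>
  Throughout, the coefficients \<open>p i n\<close> and the arguments \<open>\<sigma> i n\<close> are indexed by
  \<open>i \<in> {1..m}\<close>. Since \<open>\<sigma> i n \<ge> n + 1\<close>, the integer arguments are taken in \<^typ>\<open>nat\<close>;
  the value \<open>\<sigma> i 0\<close> is irrelevant.
\<close>

definition nabla :: "(nat \<Rightarrow> real) \<Rightarrow> nat \<Rightarrow> real" where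
  "nabla x n = x n - x (n - 1)"

definition is_solution ::
    "nat \<Rightarrow> (nat \<Rightarrow> nat \<Rightarrow> real) \<Rightarrow> (nat \<Rightarrow> nat \<Rightarrow> nat) \<Rightarrow> (nat \<Rightarrow> real) \<Rightarrow> bool" where
  "is_solution m p \<sigma> x \<longleftrightarrow>
     (\<forall>n\<ge>1. nabla x n - (\<Sum>i = 1..m. p i n * x (\<sigma> i n)) = 0)"

definition oscillatory :: "(nat \<Rightarrow> real) \<Rightarrow> bool" where
  "oscillatory x \<longleftrightarrow>
     \<not> (\<forall>\<^sub>F n in sequentially. x n > 0) \<and> \<not> (\<forall>\<^sub>F n in sequentially. x n < 0)"

text \<open>
  The infimum is over a nonempty set of natural numbers, hence a minimum.
\<close>

definition rho :: "nat \<Rightarrow> (nat \<Rightarrow> nat \<Rightarrow> nat) \<Rightarrow> nat \<Rightarrow> nat" where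
  "rho m \<sigma> n = (MIN i\<in>{1..m}. INF s\<in>{n..}. \<sigma> i s)"

text \<open>
  The family \<open>b\<^sub>r\<close> starts at \<open>r = 1\<close>; the clause for \<open>0\<close> only makes the function total and
  is not used by the others. For \<open>r \<ge> 2\<close> the value \<open>b\<^sub>r(n,k)\<close> need not be positive; if it
  vanishes, its inverse is \<open>0\<close> by the usual convention. If the equation has a nonoscillatory
  solution then, for each \<open>r\<close>, \<open>b\<^sub>r(n,k)\<close> is positive for all large \<open>n\<close>, so the convention does
  not affect the oscillation criterion.
\<close>

fun b :: "nat \<Rightarrow> (nat \<Rightarrow> nat \<Rightarrow> real) \<Rightarrow> (nat \<Rightarrow> nat \<Rightarrow> nat) \<Rightarrow> nat \<Rightarrow> nat \<Rightarrow> nat \<Rightarrow> real" where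
  "b m p \<sigma> 0 n k = 1"
| "b m p \<sigma> (Suc 0) n k = (\<Prod>i = n+1..k. 1 - (\<Sum>l = 1..m. p l i))"
| "b m p \<sigma> (Suc (Suc r)) n k =
     (\<Prod>i = n+1..k. 1 - (\<Sum>l = 1..m. p l i * (1 / b m p \<sigma> (Suc r) i (\<sigma> l i))))"

end

theory Submission
  imports Defs
begin

text \<open>
  A positive solution \<open>x\<close> is nondecreasing, because its backward difference is a sum of
  nonnegative terms. An estimate \<open>x n \<le> b\<^sub>r(n,k) x k\<close> bounds each advanced term
  \<open>x (\<sigma>\<^sub>i n)\<close> from below by a multiple of \<open>x n\<close>; reinserting this into the equation gives
  the same estimate for \<open>r + 1\<close>, with positive factors since \<open>x\<close> is positive. Summing
  the equation from \<open>n\<close> to \<open>\<rho>(n)\<close> and comparing every term with \<open>x (\<rho>(n))\<close> shows that the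
  sums in the criterion are less than 1 for all large \<open>n\<close>.
\<close>

text \<open>The value 1 at \<open>r = 0\<close> makes the recursion uniform, so that inductions can start there.\<close>

lemma b_Suc:
  "b m p \<sigma> (Suc r) n k =
     (\<Prod>i = n+1..k. 1 - (\<Sum>l = 1..m. p l i * (1 / b m p \<sigma> r i (\<sigma> l i))))"
  by (cases r) simp_all

lemma b_refl [simp]: "b m p \<sigma> r n n = 1"
  by (cases r) (simp_all add: b_Suc del: b.simps(2,3))

lemma b_Suc_Suc:
  assumes "n \<le> k"
  shows "b m p \<sigma> (Suc r) n (Suc k) =
     b m p \<sigma> (Suc r) n k *
     (1 - (\<Sum>l = 1..m. p l (Suc k) * (1 / b m p \<sigma> r (Suc k) (\<sigma> l (Suc k)))))"
  using assms by (simp add: b_Suc del: b.simps)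

lemma is_solution_Suc:
  assumes "is_solution m p \<sigma> x"
  shows "x (Suc n) = x n + (\<Sum>i = 1..m. p i (Suc n) * x (\<sigma> i (Suc n)))"
proof -
  have "nabla x (Suc n) - (\<Sum>i = 1..m. p i (Suc n) * x (\<sigma> i (Suc n))) = 0"
    using assms unfolding is_solution_def by (metis le_add1 plus_1_eq_Suc)
  then show ?thesis by (simp add: nabla_def)
qed

text \<open>The equation is linear and homogeneous, so eventually negative solutions reduce to
  eventually positive ones.\<close>

lemma is_solution_uminus:
  assumes "is_solution m p \<sigma> x"
  shows "is_solution m p \<sigma> (\<lambda>n. - x n)"
  unfolding is_solution_def
proof (intro allI impI)
  fix n :: nat
  assume "n \<ge> 1"
  with assms have "nabla x n - (\<Sum>i = 1..m. p i n * x (\<sigma> i n)) = 0"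
    unfolding is_solution_def by blast
  then show "nabla (\<lambda>n. - x n) n - (\<Sum>i = 1..m. p i n * - x (\<sigma> i n)) = 0"
    by (simp add: nabla_def sum_negf)
qed

text \<open>This puts the arguments of \<open>b\<close> in the criterion in order,
  \<open>rho m \<sigma> n \<le> \<sigma> i j\<close>, as the estimate by \<open>b\<close>
  requires.\<close>

lemma rho_le:
  assumes "i \<in> {1..m}" "n \<le> j"
  shows "rho m \<sigma> n \<le> \<sigma> i j"
proof -
  have "rho m \<sigma> n \<le> (INF s\<in>{n..}. \<sigma> i s)"
    unfolding rho_def using assms(1) by (intro Min_le) auto
  also have "\<dots> \<le> \<sigma> i j"
    using assms(2) by (intro cINF_lower) auto
  finally show ?thesis .
qed

lemma le_rho:
  assumes "m \<ge> 1" "\<And>i j. i \<in> {1..m} \<Longrightarrow> j \<ge> n \<Longrightarrow> \<sigma> i j \<ge> c"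
  shows "c \<le> rho m \<sigma> n"
  unfolding rho_def using assms by (auto intro!: Min.boundedI cINF_greatest)

lemma sum_telescope_solution:
  assumes "is_solution m p \<sigma> x" "n \<le> k"
  shows "x k = x n + (\<Sum>j = Suc n..k. \<Sum>i = 1..m. p i j * x (\<sigma> i j))"
  using assms(2)
proof (induction k rule: dec_induct)
  case (step k)
  then show ?case by (simp add: is_solution_Suc[OF assms(1), of k])
qed simp

lemma positive_solution_mono:
  assumes sol: "is_solution m p \<sigma> x"
    and pos: "\<And>n. n \<ge> N \<Longrightarrow> x n > 0"
    and p: "\<And>i n. i \<in> {1..m} \<Longrightarrow> p i n \<ge> 0"
    and \<sigma>: "\<And>i n. i \<in> {1..m} \<Longrightarrow> n \<ge> 1 \<Longrightarrow> \<sigma> i n \<ge> n"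
    and "N \<le> n" "n \<le> k"
  shows "x n \<le> x k"
proof -
  have "(\<Sum>j = Suc n..k. \<Sum>i = 1..m. p i j * x (\<sigma> i j)) \<ge> 0"
  proof (intro sum_nonneg mult_nonneg_nonneg p)
    fix j i assume "j \<in> {Suc n..k}" "i \<in> {1..m}"
    then have "N \<le> \<sigma> i j" using \<sigma>[of i j] \<open>N \<le> n\<close> by auto
    then show "0 \<le> x (\<sigma> i j)" using pos less_imp_le by blast
  qed
  then show ?thesis
    using sum_telescope_solution[OF sol \<open>n \<le> k\<close>] by linarith
qed

text \<open>Positivity and the estimate go through the induction together: the estimate can be
  divided by \<open>b\<close> only if \<open>b\<close> is positive, and the divided estimate makes
  the factors at the next level positive.\<close>

lemma positive_solution_b:
  assumes sol: "is_solution m p \<sigma> x"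
    and pos: "\<And>n. n \<ge> N \<Longrightarrow> x n > 0"
    and p: "\<And>i n. i \<in> {1..m} \<Longrightarrow> p i n \<ge> 0"
    and \<sigma>: "\<And>i n. i \<in> {1..m} \<Longrightarrow> n \<ge> 1 \<Longrightarrow> \<sigma> i n \<ge> n"
    and "N \<le> n" "n \<le> k"
  shows "b m p \<sigma> r n k > 0 \<and> x n \<le> b m p \<sigma> r n k * x k"
  using \<open>N \<le> n\<close> \<open>n \<le> k\<close>
proof (induction r arbitrary: n k)
  case 0
  with positive_solution_mono[OF sol pos p \<sigma>] show ?case by simp
next
  case (Suc r)
  show ?case
    \<comment> \<open>With \<open>r\<close> and \<open>n\<close> fixed, the product grows by one
      factor at a time; the outer hypothesis stays available for all pairs of arguments.\<close>
    using \<open>n \<le> k\<close>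
  proof (induction k rule: dec_induct)
    case (step k)
    define F where "F = 1 - (\<Sum>l = 1..m. p l (Suc k) * (1 / b m p \<sigma> r (Suc k) (\<sigma> l (Suc k))))"
    have xpos: "x k > 0" "x (Suc k) > 0" using pos step Suc.prems by auto
    \<comment> \<open>The level \<open>r\<close> estimate, taken from \<open>Suc k\<close> to each
      advanced argument, bounds the right-hand side of the equation by a multiple of
      \<open>x (Suc k)\<close>.\<close>
    have "(\<Sum>l = 1..m. p l (Suc k) * (1 / b m p \<sigma> r (Suc k) (\<sigma> l (Suc k)))) * x (Suc k)
        \<le> (\<Sum>l = 1..m. p l (Suc k) * x (\<sigma> l (Suc k)))"
      unfolding sum_distrib_right mult.assoc
    proof (intro sum_mono mult_left_mono p)
      fix l assume l: "l \<in> {1..m}"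
      from Suc.IH[of "Suc k" "\<sigma> l (Suc k)"] \<sigma>[OF l, of "Suc k"] step Suc.prems
      show "1 / b m p \<sigma> r (Suc k) (\<sigma> l (Suc k)) * x (Suc k) \<le> x (\<sigma> l (Suc k))"
        by (simp add: pos_divide_le_eq mult.commute)
    qed
    then have le: "x k \<le> F * x (Suc k)"
      using is_solution_Suc[OF sol, of k] by (simp add: F_def left_diff_distrib)
    \<comment> \<open>The sign of the factor is forced by the solution:
      \<open>0 < x k \<le> F * x (Suc k)\<close> with \<open>x (Suc k) > 0\<close>.\<close>
    with xpos have "F > 0"
      by (meson less_le_trans zero_less_mult_pos2)
    moreover have "b m p \<sigma> (Suc r) n (Suc k) = b m p \<sigma> (Suc r) n k * F"
      unfolding F_def using step by (intro b_Suc_Suc) simp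
    moreover have "x n \<le> b m p \<sigma> (Suc r) n k * (F * x (Suc k))"
      using step.IH le by (meson less_imp_le mult_left_mono order_trans)
    ultimately show ?case using step.IH by (simp add: mult.assoc)
  qed simp
qed

text \<open>After multiplication by \<open>x (rho m \<sigma> n)\<close>, the sum is at most the
  increase of \<open>x\<close> from \<open>n - 1\<close> to \<open>rho m \<sigma> n\<close>. The
  strict \<open>N < n\<close> makes \<open>x (n - 1)\<close> positive, whence the strict
  inequality.\<close>

lemma positive_solution_sum_less_1:
  assumes sol: "is_solution m p \<sigma> x"
    and pos: "\<And>n. n \<ge> N \<Longrightarrow> x n > 0"
    and p: "\<And>i n. i \<in> {1..m} \<Longrightarrow> p i n \<ge> 0"
    and \<sigma>: "\<And>i n. i \<in> {1..m} \<Longrightarrow> n \<ge> 1 \<Longrightarrow> \<sigma> i n \<ge> n"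
    and "m \<ge> 1" "N < n"
  shows "(\<Sum>j = n..rho m \<sigma> n. \<Sum>i = 1..m. p i j * (1 / b m p \<sigma> r (rho m \<sigma> n) (\<sigma> i j))) < 1"
    (is "?S < 1")
proof -
  define R where "R = rho m \<sigma> n"
  have "n \<le> R"
    unfolding R_def
  proof (rule le_rho[OF \<open>m \<ge> 1\<close>])
    fix i j assume "i \<in> {1..m}" "j \<ge> n"
    then show "n \<le> \<sigma> i j" using \<sigma>[of i j] \<open>N < n\<close> by linarith
  qed
  have "?S * x R \<le> (\<Sum>j = n..R. \<Sum>i = 1..m. p i j * x (\<sigma> i j))"
    unfolding sum_distrib_right mult.assoc R_def[symmetric]
  proof (intro sum_mono mult_left_mono p)
    fix j i assume "j \<in> {n..R}" "i \<in> {1..m}"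
    then have "R \<le> \<sigma> i j" unfolding R_def by (intro rho_le) auto
    moreover have "N \<le> R" using \<open>n \<le> R\<close> \<open>N < n\<close> by simp
    ultimately show "1 / b m p \<sigma> r R (\<sigma> i j) * x R \<le> x (\<sigma> i j)"
      using positive_solution_b[OF sol pos p \<sigma>, of N R "\<sigma> i j" r]
      by (simp add: pos_divide_le_eq mult.commute)
  qed
  \<comment> \<open>The sum includes the index \<open>n\<close>, so the telescoping starts at
    \<open>n - 1\<close>.\<close>
  also have "\<dots> = x R - x (n - 1)"
    using sum_telescope_solution[OF sol, of "n - 1" R] \<open>n \<le> R\<close> \<open>N < n\<close> by simp
  also have "\<dots> < 1 * x R"
    using pos[of "n - 1"] \<open>N < n\<close> by simp
  finally show ?thesis
    using pos[of R] \<open>n \<le> R\<close> \<open>N < n\<close> by (subst (asm) mult_less_cancel_right_pos) auto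
qed

theorem theorem2:
  fixes m r :: nat
    and p :: "nat \<Rightarrow> nat \<Rightarrow> real"
    and \<sigma> :: "nat \<Rightarrow> nat \<Rightarrow> nat"
  assumes "m \<ge> 1"
    and "\<And>i n. i \<in> {1..m} \<Longrightarrow> p i n \<ge> 0"
    and "\<And>n. (\<Sum>i = 1..m. p i n) < 1"
    and "\<And>i n. i \<in> {1..m} \<Longrightarrow> n \<ge> 1 \<Longrightarrow> \<sigma> i n \<ge> n + 1"
    and "r \<ge> 1"
    and "limsup (\<lambda>n. ereal (\<Sum>j = n..rho m \<sigma> n. \<Sum>i = 1..m.
                       p i j * (1 / b m p \<sigma> r (rho m \<sigma> n) (\<sigma> i j)))) > 1"
  shows "\<forall>x. is_solution m p \<sigma> x \<longrightarrow> oscillatory x"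
proof -
  have \<sigma>: "\<sigma> i n \<ge> n" if "i \<in> {1..m}" "n \<ge> 1" for i n
    using assms(4)[OF that] by simp
  have not_pos: "\<not> (\<forall>\<^sub>F n in sequentially. x n > 0)" if sol: "is_solution m p \<sigma> x" for x
  proof
    assume "\<forall>\<^sub>F n in sequentially. x n > 0"
    then obtain N where N: "\<And>n. n \<ge> N \<Longrightarrow> x n > 0"
      unfolding eventually_sequentially by blast
    \<comment> \<open>Strict bounds by 1 survive in the limit superior only as
      \<open>\<le> 1\<close>, which still contradicts the strict criterion.\<close>
    have "limsup (\<lambda>n. ereal (\<Sum>j = n..rho m \<sigma> n. \<Sum>i = 1..m.
            p i j * (1 / b m p \<sigma> r (rho m \<sigma> n) (\<sigma> i j)))) \<le> 1"
    proof (rule Limsup_bounded)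
      show "\<forall>\<^sub>F n in sequentially. ereal (\<Sum>j = n..rho m \<sigma> n. \<Sum>i = 1..m.
            p i j * (1 / b m p \<sigma> r (rho m \<sigma> n) (\<sigma> i j))) \<le> 1"
        using eventually_gt_at_top[of N]
      proof eventually_elim
        case (elim n)
        from positive_solution_sum_less_1[OF sol N assms(2) \<sigma> assms(1) elim]
        show ?case by (simp add: one_ereal_def less_imp_le)
      qed
    qed
    with assms(6) show False by (simp add: not_le[symmetric])
  qed
  show ?thesis
    using not_pos not_pos[OF is_solution_uminus] by (auto simp: oscillatory_def)
qed

end
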